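(* Let $n,p\ge1$. A tensor $\mathcal{S}\in\mathbb{C}^{2n\times2n\times p}$ is T-symplectic if and only if each of its Fourier-domain slices $\widehat{\boldsymbol{S}}^{(i)}$, $i=1,\dots,p$, is a symplectic matrix.
   Context: A tensor $\mathcal{A}\in\mathbb{C}^{m\times n\times p}$ has frontal slices $\boldsymbol{A}^{(1)},\dots,\boldsymbol{A}^{(p)}\in\mathbb{C}^{m\times n}$. With $\omega=e^{2\pi\sqrt{-1}/p}$, its Fourier-domain slices are $\widehat{\boldsymbol{A}}^{(i)}=\sum_{j=1}^{p}\omega^{(i-1)(j-1)}\boldsymbol{A}^{(j)}$, $i=1,\dots,p$. Let $\operatorname{bcirc}(\mathcal{A})\in\mathbb{C}^{mp\times np}$ be the block circulant matrix whose $(r,s)$ block is $\boldsymbol{A}^{(((r-s)\bmod p)+1)}$. The T-product $\mathcal{A}*\mathcal{B}$ is the tensor with $\operatorname{bcirc}(\mathcal{A}*\mathcal{B})=\operatorname{bcirc}(\mathcal{A})\operatorname{bcirc}(\mathcal{B})$; equivalently, if $\mathcal{C}=\mathcal{A}*\mathcal{B}$ then $\widehat{\boldsymbol{C}}^{(i)}=\widehat{\boldsymbol{A}}^{(i)}\widehat{\boldsymbol{B}}^{(i)}$ for all $i$. The T-conjugate transpose $\mathcal{A}^H$ has frontal slices $(\boldsymbol{A}^{(1)})^H$ for $k=1$ and $(\boldsymbol{A}^{(p-k+2)})^H$ for $k\ge2$ (so that $\operatorname{bcirc}(\mathcal{A}^H)=\operatorname{bcirc}(\mathcal{A})^H$).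 Let $\boldsymbol{J}=\begin{bmatrix}\boldsymbol{0}&\boldsymbol{I}_n\\-\boldsymbol{I}_n&\boldsymbol{0}\end{bmatrix}$. The T-symplectic unit tensor $\mathcal{J}\in\mathbb{R}^{2n\times2n\times p}$ is the tensor all of whose Fourier-domain slices equal $\boldsymbol{J}$. A matrix $\boldsymbol{S}\in\mathbb{C}^{2n\times2n}$ is symplectic if $\boldsymbol{S}^H\boldsymbol{J}\boldsymbol{S}=\boldsymbol{J}$ (conjugate transpose). A tensor $\mathcal{S}\in\mathbb{C}^{2n\times2n\times p}$ is T-symplectic if $\mathcal{S}^H*\mathcal{J}*\mathcal{S}=\mathcal{J}$. *)

theory Defs
  imports Complex_Main "Jordan_Normal_Form.Schur_Decomposition"
begin

text \<open>
  A third-order tensor is the list of its frontal slices, all of the same dimensions. Slices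
  (frontal and Fourier-domain) are indexed from 0, so the slice with index \<open>k\<close> here is the one
  usually numbered \<open>k + 1\<close>. Row and column dimensions are read off the first slice, hence all
  definitions are meant for nonempty lists, i.e. \<open>p \<ge> 1\<close>.
\<close>

type_synonym tensor = "complex mat list"

definition carrier_tensor :: "nat \<Rightarrow> nat \<Rightarrow> nat \<Rightarrow> tensor set" where
  "carrier_tensor m n p = {A. length A = p \<and> (\<forall>k<p. A ! k \<in> carrier_mat m n)}"

definition t_rows :: "tensor \<Rightarrow> nat" where
  "t_rows A = dim_row (A ! 0)"

definition t_cols :: "tensor \<Rightarrow> nat" where
  "t_cols A = dim_col (A ! 0)"

definition fourier_slice :: "tensor \<Rightarrow> nat \<Rightarrow> complex mat" where
  "fourier_slice A i =
     (let p = length A; \<omega> = exp (2 * complex_of_real pi * \<i> / of_nat p)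
      in mat (t_rows A) (t_cols A) (\<lambda>(a, b). \<Sum>j<p. \<omega> ^ (i * j) * (A ! j) $$ (a, b)))"

text \<open>The \<open>(r, s)\<close> block is the frontal slice with index \<open>(r - s) mod p\<close>; the summand \<open>p\<close> avoids
  truncated subtraction, as \<open>s < p\<close>.\<close>

definition bcirc :: "tensor \<Rightarrow> complex mat" where
  "bcirc A =
     (let m = t_rows A; n = t_cols A; p = length A
      in mat (m * p) (n * p) (\<lambda>(i, j).
           (A ! ((i div m + p - j div n) mod p)) $$ (i mod m, j mod n)))"

text \<open>Existence and uniqueness of the tensors selected by \<open>t_prod\<close> and \<open>t_symp_unit\<close> are proved
  below.\<close>

definition t_prod :: "tensor \<Rightarrow> tensor \<Rightarrow> tensor" (infixl "*\<^sub>T" 70) where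
  "A *\<^sub>T B = (THE C. C \<in> carrier_tensor (t_rows A) (t_cols B) (length A) \<and>
                   bcirc C = bcirc A * bcirc B)"

definition t_adjoint :: "tensor \<Rightarrow> tensor" where
  "t_adjoint A = map (\<lambda>k. mat_adjoint (if k = 0 then A ! 0 else A ! (length A - k))) [0..<length A]"

definition symp_unit :: "nat \<Rightarrow> complex mat" where
  "symp_unit n = four_block_mat (0\<^sub>m n n) (1\<^sub>m n) (- 1\<^sub>m n) (0\<^sub>m n n)"

definition t_symp_unit :: "nat \<Rightarrow> nat \<Rightarrow> tensor" where
  "t_symp_unit n p = (THE T. T \<in> carrier_tensor (2 * n) (2 * n) p \<and>
                            (\<forall>i<p. fourier_slice T i = symp_unit n))"

definition symplectic :: "nat \<Rightarrow> complex mat \<Rightarrow> bool" where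
  "symplectic n S \<longleftrightarrow> S \<in> carrier_mat (2 * n) (2 * n) \<and>
     mat_adjoint S * symp_unit n * S = symp_unit n"

definition t_symplectic :: "nat \<Rightarrow> nat \<Rightarrow> tensor \<Rightarrow> bool" where
  "t_symplectic n p S \<longleftrightarrow> S \<in> carrier_tensor (2 * n) (2 * n) p \<and>
     t_adjoint S *\<^sub>T t_symp_unit n p *\<^sub>T S = t_symp_unit n p"


subsection \<open>Well-definedness\<close>

lemma carrier_tensorD:
  assumes "A \<in> carrier_tensor m n p"
  shows "length A = p" "k < p \<Longrightarrow> A ! k \<in> carrier_mat m n"
    "p > 0 \<Longrightarrow> t_rows A = m" "p > 0 \<Longrightarrow> t_cols A = n"
  using assms by (auto simp: carrier_tensor_def t_rows_def t_cols_def)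

lemma bcirc_index:
  assumes "A \<in> carrier_tensor m n p" "p > 0" "i < m * p" "j < n * p"
  shows "bcirc A $$ (i, j) = (A ! ((i div m + p - j div n) mod p)) $$ (i mod m, j mod n)"
  using assms by (simp add: bcirc_def Let_def carrier_tensorD[OF assms(1)])

lemma bcirc_carrier:
  assumes "A \<in> carrier_tensor m n p" "p > 0"
  shows "bcirc A \<in> carrier_mat (m * p) (n * p)"
  using assms by (simp add: bcirc_def Let_def carrier_tensorD[OF assms(1)])

lemma tensor_eqI:
  assumes "A \<in> carrier_tensor m n p" "B \<in> carrier_tensor m n p"
    and "\<And>k a b. k < p \<Longrightarrow> a < m \<Longrightarrow> b < n \<Longrightarrow> (A ! k) $$ (a, b) = (B ! k) $$ (a, b)"
  shows "A = B"
proof (rule nth_equalityI)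
  show "length A = length B" using carrier_tensorD(1)[OF assms(1)] carrier_tensorD(1)[OF assms(2)] by simp
  fix k assume "k < length A"
  then have k: "k < p" using carrier_tensorD(1)[OF assms(1)] by simp
  show "A ! k = B ! k"
    using carrier_tensorD(2)[OF assms(1) k] carrier_tensorD(2)[OF assms(2) k] assms(3)[OF k]
    by (intro eq_matI) auto
qed

lemma bcirc_inj:
  assumes A: "A \<in> carrier_tensor m n p" and B: "B \<in> carrier_tensor m n p"
    and p: "p > 0" and eq: "bcirc A = bcirc B"
  shows "A = B"
proof (rule tensor_eqI[OF A B])
  fix k a b assume k: "k < p" and a: "a < m" and b: "b < n"
  have "k * m + a < Suc k * m" using a by simp
  also have "\<dots> \<le> p * m" using k by (intro mult_le_mono1) simp
  finally have i: "k * m + a < m * p" by (simp add: mult.commute)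
  have "n * 1 \<le> n * p" using p by (intro mult_le_mono2) simp
  then have j: "b < n * p" using b by linarith
  have d: "(k * m + a) div m = k" "(k * m + a) mod m = a" "b div n = 0" "b mod n = b"
    using a b by auto
  show "(A ! k) $$ (a, b) = (B ! k) $$ (a, b)"
    using bcirc_index[OF A p i j] bcirc_index[OF B p i j] eq k d by simp
qed

lemma sum_blocks:
  fixes f :: "nat \<Rightarrow> nat \<Rightarrow> complex"
  shows "(\<Sum>q<n * p. f (q div n) (q mod n)) = (\<Sum>s<p. \<Sum>c<n. f s c)"
proof -
  have "(\<Sum>q<n * p. f (q div n) (q mod n)) = (\<Sum>s<p. \<Sum>q\<in>{s * n..<s * n + n}. f (q div n) (q mod n))"
    using sum.nat_group[of "\<lambda>q. f (q div n) (q mod n)" n p] by (simp add: mult.commute)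
  also have "\<dots> = (\<Sum>s<p. \<Sum>c<n. f s c)"
  proof (rule sum.cong[OF refl])
    fix s
    have "(\<Sum>q\<in>{s * n..<s * n + n}. f (q div n) (q mod n)) =
          (\<Sum>c<n. f ((c + s * n) div n) ((c + s * n) mod n))"
      using sum.shift_bounds_nat_ivl[of "\<lambda>q. f (q div n) (q mod n)" 0 "s * n" n]
      by (simp add: add.commute atLeast0LessThan)
    also have "\<dots> = (\<Sum>c<n. f s c)" by (intro sum.cong) auto
    finally show "(\<Sum>q\<in>{s * n..<s * n + n}. f (q div n) (q mod n)) = (\<Sum>c<n. f s c)" .
  qed
  finally show ?thesis .
qed

lemma circ_shift_bij:
  fixes p t :: nat
  assumes "t < p"
  shows "bij_betw (\<lambda>s. (s + p - t) mod p) {..<p} {..<p}"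
proof (rule bij_betw_byWitness[where f' = "\<lambda>s. (s + t) mod p"])
  show "\<forall>s\<in>{..<p}. ((s + p - t) mod p + t) mod p = s"
    using assms by (auto simp: mod_add_left_eq)
  show "\<forall>s\<in>{..<p}. ((s + t) mod p + p - t) mod p = s"
  proof
    fix s assume s: "s \<in> {..<p}"
    have "((s + t) mod p + p - t) mod p = ((s + t) mod p + (p - t)) mod p" using assms by simp
    also have "\<dots> = (s + t + (p - t)) mod p" by (simp add: mod_add_left_eq)
    finally show "((s + t) mod p + p - t) mod p = s" using assms s by simp
  qed
qed (use assms in auto)

lemma circ_index:
  fixes p r s t :: nat
  assumes "r < p" "s < p" "t < p"
  shows "((r + p - t) mod p + p - (s + p - t) mod p) mod p = (r + p - s) mod p"
proof -
  have "int (((r + p - t) mod p + p - (s + p - t) mod p) mod p)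
      = ((int r + int p - int t) mod int p + int p - (int s + int p - int t) mod int p) mod int p"
    using assms by (simp add: of_nat_mod of_nat_diff less_imp_le trans_le_add2)
  also have "\<dots> = ((int r + int p - int t) + int p - (int s + int p - int t)) mod int p"
    by (metis (no_types, opaque_lifting) mod_add_left_eq mod_diff_eq mod_mod_trivial)
  also have "\<dots> = (int r - int s + int p) mod int p" by (simp add: algebra_simps)
  also have "\<dots> = int ((r + p - s) mod p)"
    using assms by (simp add: of_nat_mod of_nat_diff less_imp_le trans_le_add2 algebra_simps del: mod_add_self2 mod_add_self1)
  finally show ?thesis by simp
qed

lemma t_prod_ex:
  assumes A: "A \<in> carrier_tensor m n p" and B: "B \<in> carrier_tensor n l p" and p: "p > 0"
  shows "\<exists>C \<in> carrier_tensor m l p. bcirc C = bcirc A * bcirc B"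
proof -
  define C where "C = map (\<lambda>k. mat m l (\<lambda>(a, b). \<Sum>s<p. \<Sum>c<n.
      (A ! ((k + p - s) mod p)) $$ (a, c) * (B ! s) $$ (c, b))) [0..<p]"
  have C: "C \<in> carrier_tensor m l p" by (auto simp: C_def carrier_tensor_def)
  note cA = bcirc_carrier[OF A p] and cB = bcirc_carrier[OF B p] and cC = bcirc_carrier[OF C p]
  have "bcirc C = bcirc A * bcirc B"
  proof (rule eq_matI)
    fix i j assume "i < dim_row (bcirc A * bcirc B)" "j < dim_col (bcirc A * bcirc B)"
    then have i: "i < m * p" and j: "j < l * p" using cA cB by auto
    define r a t b where "r = i div m" and "a = i mod m" and "t = j div l" and "b = j mod l"
    have r: "r < p" and t: "t < p" using i j by (auto simp: r_def t_def less_mult_imp_div_less mult.commute)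
    have a: "a < m" and b: "b < l" using i j by (auto simp: a_def b_def intro!: mod_less_divisor gr0I)
    define F where "F = (\<lambda>s. \<Sum>c<n. (A ! (((r + p - t) mod p + p - s) mod p)) $$ (a, c) * (B ! s) $$ (c, b))"
    have "(bcirc A * bcirc B) $$ (i, j) = (\<Sum>q<n * p. bcirc A $$ (i, q) * bcirc B $$ (q, j))"
      using cA cB i j by (simp add: scalar_prod_def atLeast0LessThan)
    also have "\<dots> = (\<Sum>q<n * p. (A ! ((r + p - q div n) mod p)) $$ (a, q mod n) *
                              (B ! ((q div n + p - t) mod p)) $$ (q mod n, b))"
      by (intro sum.cong refl)
        (simp add: bcirc_index[OF A p i] bcirc_index[OF B p _ j] r_def a_def t_def b_def)
    also have "\<dots> = (\<Sum>s<p. \<Sum>c<n. (A ! ((r + p - s) mod p)) $$ (a, c) * (B ! ((s + p - t) mod p)) $$ (c, b))"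
      by (rule sum_blocks)
    also have "\<dots> = (\<Sum>s<p. F ((s + p - t) mod p))"
      unfolding F_def using r t by (intro sum.cong refl) (simp add: circ_index)
    also have "\<dots> = (\<Sum>s<p. F s)"
      by (rule sum.reindex_bij_betw[OF circ_shift_bij[OF t]])
    also have "\<dots> = (C ! ((r + p - t) mod p)) $$ (a, b)"
      using a b p by (simp add: C_def F_def)
    also have "\<dots> = bcirc C $$ (i, j)"
      using bcirc_index[OF C p i j] by (simp add: r_def a_def t_def b_def)
    finally show "bcirc C $$ (i, j) = (bcirc A * bcirc B) $$ (i, j)" by simp
  qed (use cA cB cC in auto)
  with C show ?thesis by blast
qed

lemma t_prod_eqI:
  assumes A: "A \<in> carrier_tensor m n p" and B: "B \<in> carrier_tensor n l p" and p: "p > 0"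
    and C: "C \<in> carrier_tensor m l p" "bcirc C = bcirc A * bcirc B"
  shows "A *\<^sub>T B = C"
  unfolding t_prod_def
proof (rule the_equality)
  show "C \<in> carrier_tensor (t_rows A) (t_cols B) (length A) \<and> bcirc C = bcirc A * bcirc B"
    using C p by (simp add: carrier_tensorD[OF A] carrier_tensorD[OF B])
  fix D assume "D \<in> carrier_tensor (t_rows A) (t_cols B) (length A) \<and> bcirc D = bcirc A * bcirc B"
  then show "D = C"
    using C p bcirc_inj[of D m l p C] by (simp add: carrier_tensorD[OF A] carrier_tensorD[OF B])
qed

lemma t_prod_carrier:
  assumes "A \<in> carrier_tensor m n p" "B \<in> carrier_tensor n l p" "p > 0"
  shows "A *\<^sub>T B \<in> carrier_tensor m l p" "bcirc (A *\<^sub>T B) = bcirc A * bcirc B"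
  using t_prod_ex[OF assms] t_prod_eqI[OF assms] by auto

lemma fourier_slice_index:
  assumes "A \<in> carrier_tensor m n p" "p > 0" "a < m" "b < n"
  shows "fourier_slice A i $$ (a, b) =
    (\<Sum>j<p. exp (2 * complex_of_real pi * \<i> / of_nat p) ^ (i * j) * (A ! j) $$ (a, b))"
  using assms by (simp add: fourier_slice_def Let_def carrier_tensorD[OF assms(1)])

lemma fourier_slice_carrier:
  assumes "A \<in> carrier_tensor m n p" "p > 0"
  shows "fourier_slice A i \<in> carrier_mat m n"
  using assms by (simp add: fourier_slice_def Let_def carrier_tensorD[OF assms(1)])

lemma root_power:
  "exp (2 * complex_of_real pi * \<i> / of_nat p) ^ k = cis (2 * pi * real k / real p)"
  by (simp add: cis_conv_exp exp_of_nat_mult[symmetric] mult_ac)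

lemma root_orthogonal:
  assumes p: "p > 0" and jk: "j < p" "k < p"
  defines "\<omega> \<equiv> exp (2 * complex_of_real pi * \<i> / of_nat p)"
  shows "(\<Sum>i<p. inverse \<omega> ^ (i * k) * \<omega> ^ (i * j)) = (if j = k then of_nat p else 0)"
proof -
  have nz: "\<omega> \<noteq> 0" by (simp add: \<omega>_def)
  have one: "\<omega> ^ p = 1" using p by (simp add: \<omega>_def root_power)
  define z where "z = \<omega> ^ j / \<omega> ^ k"
  have "(\<Sum>i<p. inverse \<omega> ^ (i * k) * \<omega> ^ (i * j)) = (\<Sum>i<p. z ^ i)"
    by (intro sum.cong refl)
      (simp add: z_def power_divide power_mult[symmetric] field_simps mult.commute power_inverse nz)
  moreover have "z = 1" if "j = k" using that nz by (simp add: z_def)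
  moreover have "(\<Sum>i<p. z ^ i) = 0" if "j \<noteq> k"
  proof -
    have "\<omega> ^ j \<noteq> \<omega> ^ k"
      using bij_betw_imp_inj_on[OF bij_betw_roots_unity[OF p]] jk that
      by (auto simp: \<omega>_def root_power inj_on_def)
    then have "z \<noteq> 1" using nz by (simp add: z_def)
    moreover have "z ^ p = 1"
      by (simp add: z_def power_divide power_mult[symmetric] mult.commute[of _ p])
        (simp add: power_mult one nz)
    ultimately show ?thesis by (simp add: sum_gp_strict)
  qed
  ultimately show ?thesis by auto
qed

lemma fourier_slice_inj:
  assumes A: "A \<in> carrier_tensor m n p" and B: "B \<in> carrier_tensor m n p" and p: "p > 0"
    and eq: "\<And>i. i < p \<Longrightarrow> fourier_slice A i = fourier_slice B i"
  shows "A = B"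
proof (rule tensor_eqI[OF A B])
  fix k a b assume k: "k < p" and a: "a < m" and b: "b < n"
  define \<omega> where "\<omega> = exp (2 * complex_of_real pi * \<i> / of_nat p)"
  have inv: "(\<Sum>i<p. inverse \<omega> ^ (i * k) * fourier_slice C i $$ (a, b)) = of_nat p * (C ! k) $$ (a, b)"
    if C: "C \<in> carrier_tensor m n p" for C
  proof -
    have "(\<Sum>i<p. inverse \<omega> ^ (i * k) * fourier_slice C i $$ (a, b)) =
        (\<Sum>i<p. \<Sum>j<p. inverse \<omega> ^ (i * k) * \<omega> ^ (i * j) * (C ! j) $$ (a, b))"
      by (simp add: fourier_slice_index[OF C p a b] \<omega>_def sum_distrib_left mult.assoc)
    also have "\<dots> = (\<Sum>j<p. (\<Sum>i<p. inverse \<omega> ^ (i * k) * \<omega> ^ (i * j)) * (C ! j) $$ (a, b))"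
      by (subst sum.swap) (simp add: sum_distrib_right)
    also have "\<dots> = (\<Sum>j<p. if j = k then of_nat p * (C ! j) $$ (a, b) else 0)"
      by (intro sum.cong refl) (simp add: root_orthogonal[OF p _ k, folded \<omega>_def])
    also have "\<dots> = of_nat p * (C ! k) $$ (a, b)" using k by (simp add: sum.delta)
    finally show ?thesis .
  qed
  have "of_nat p * (A ! k) $$ (a, b) = of_nat p * (B ! k) $$ (a, b)"
    unfolding inv[OF A, symmetric] inv[OF B, symmetric] using eq by simp
  then show "(A ! k) $$ (a, b) = (B ! k) $$ (a, b)" using p by simp
qed

lemma symp_unit_carrier: "symp_unit n \<in> carrier_mat (2 * n) (2 * n)"
  by (simp add: symp_unit_def mult_2)

lemma t_symp_unit_eq:
  assumes p: "p > 0"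
  shows "t_symp_unit n p = symp_unit n # replicate (p - 1) (0\<^sub>m (2 * n) (2 * n))" (is "_ = ?T")
    and "t_symp_unit n p \<in> carrier_tensor (2 * n) (2 * n) p"
    and "i < p \<Longrightarrow> fourier_slice (t_symp_unit n p) i = symp_unit n"
proof -
  have T: "?T \<in> carrier_tensor (2 * n) (2 * n) p"
    using p symp_unit_carrier[of n] by (auto simp: carrier_tensor_def nth_Cons split: nat.split)
  have nth: "(?T ! j) $$ (a, b) = (if j = 0 then symp_unit n $$ (a, b) else 0)"
    if "j < p" "a < 2 * n" "b < 2 * n" for j a b
    using that by (cases j) auto
  have F: "fourier_slice ?T i = symp_unit n" for i
  proof (rule eq_matI)
    fix a b assume "a < dim_row (symp_unit n)" "b < dim_col (symp_unit n)"
    then have ab: "a < 2 * n" "b < 2 * n" using symp_unit_carrier[of n] by auto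
    have "fourier_slice ?T i $$ (a, b) = (\<Sum>j<p. if j = 0 then symp_unit n $$ (a, b) else 0)"
      unfolding fourier_slice_index[OF T p ab] by (intro sum.cong refl) (simp add: nth ab)
    then show "fourier_slice ?T i $$ (a, b) = symp_unit n $$ (a, b)" using p by simp
  qed (use fourier_slice_carrier[OF T p, of i] symp_unit_carrier[of n] in auto)
  show eq: "t_symp_unit n p = ?T"
    unfolding t_symp_unit_def
  proof (rule the_equality)
    fix U assume "U \<in> carrier_tensor (2 * n) (2 * n) p \<and> (\<forall>i<p. fourier_slice U i = symp_unit n)"
    then show "U = ?T" using fourier_slice_inj[OF _ T p, of U] F by simp
  qed (use T F in simp)
  show "t_symp_unit n p \<in> carrier_tensor (2 * n) (2 * n) p"
    and "i < p \<Longrightarrow> fourier_slice (t_symp_unit n p) i = symp_unit n"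
    using T F eq by simp_all
qed

end

theory Submission
  imports Defs
begin

text \<open>
  The discrete Fourier transform of the frontal slices turns the T-product into the slicewise
  matrix product and the T-conjugate transpose into the slicewise conjugate transpose. As it is
  injective, the equation defining a T-symplectic tensor holds iff it holds in every Fourier slice.
\<close>

text \<open>The product is specified only through \<open>bcirc\<close>, and a block circulant matrix
  is determined by its first block column. Reading off that column of
  \<open>bcirc A * bcirc B\<close> shows that the product is the cyclic convolution of the
  slices.\<close>

lemma t_prod_index:
  assumes A: "A \<in> carrier_tensor m n p" and B: "B \<in> carrier_tensor n l p" and p: "p > 0"
    and k: "k < p" and a: "a < m" and b: "b < l"
  shows "((A *\<^sub>T B) ! k) $$ (a, b) =
    (\<Sum>s<p. \<Sum>c<n. (A ! ((k + p - s) mod p)) $$ (a, c) * (B ! s) $$ (c, b))"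
proof -
  note C = t_prod_carrier[OF A B p]
  note cA = bcirc_carrier[OF A p] and cB = bcirc_carrier[OF B p]
  have "k * m + a < Suc k * m" using a by simp
  also have "\<dots> \<le> p * m" using k by (intro mult_le_mono1) simp
  finally have i: "k * m + a < m * p" by (simp add: mult.commute)
  have "l * 1 \<le> l * p" using p by (intro mult_le_mono2) simp
  then have j: "b < l * p" using b by linarith
  have d: "(k * m + a) div m = k" "(k * m + a) mod m = a" "b div l = 0" "b mod l = b"
    using a b by auto
  \<comment> \<open>Row \<open>k * m + a\<close> lies in block row \<open>k\<close>, and column
    \<open>b < l\<close> in block column 0, so this entry belongs to the slice with index
    \<open>(k + p - 0) mod p = k\<close>.\<close>
  have "((A *\<^sub>T B) ! k) $$ (a, b) = (bcirc A * bcirc B) $$ (k * m + a, b)"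
    using bcirc_index[OF C(1) p i j] d k by (simp add: C(2))
  also have "\<dots> = (\<Sum>q<n * p. bcirc A $$ (k * m + a, q) * bcirc B $$ (q, b))"
    using cA cB i j by (simp add: scalar_prod_def atLeast0LessThan)
  also have "\<dots> = (\<Sum>q<n * p. (A ! ((k + p - q div n) mod p)) $$ (a, q mod n) *
                            (B ! ((q div n + p) mod p)) $$ (q mod n, b))"
    by (intro sum.cong refl) (simp add: bcirc_index[OF A p i] bcirc_index[OF B p _ j] d a)
  also have "\<dots> = (\<Sum>s<p. \<Sum>c<n. (A ! ((k + p - s) mod p)) $$ (a, c) * (B ! ((s + p) mod p)) $$ (c, b))"
    by (rule sum_blocks)
  finally show ?thesis by simp
qed

text \<open>Since \<omega> is a \<open>p\<close>-th root of unity, its exponents matter only modulo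
  \<open>p\<close>. This allows computing with the reduced cyclic indices of the slices.\<close>

lemma root_power_mod:
  assumes "p > 0" and "k mod p = l mod p"
  defines "\<omega> \<equiv> exp (2 * complex_of_real pi * \<i> / of_nat p)"
  shows "\<omega> ^ (i * k) = \<omega> ^ (i * l)"
proof -
  have "\<omega> ^ p = 1" using assms(1) by (simp add: \<omega>_def root_power)
  moreover have "i * j = p * (i * (j div p)) + i * (j mod p)" for j
    by (metis distrib_left mult.left_commute mult_div_mod_eq)
  ultimately have *: "\<omega> ^ (i * j) = \<omega> ^ (i * (j mod p))" for j
    by (metis mult_1 power_add power_mult power_one)
  show ?thesis using *[of k] *[of l] assms(2) by simp
qed

text \<open>This is the convolution theorem with matrix coefficients: the character
  \<open>k \<mapsto> \<omega> ^ (i * k)\<close> is multiplicative along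
  \<open>k = (k - s) + s\<close> modulo \<open>p\<close>, so the transform of a cyclic convolution
  factors.\<close>

lemma fourier_slice_t_prod:
  assumes A: "A \<in> carrier_tensor m n p" and B: "B \<in> carrier_tensor n l p" and p: "p > 0"
  shows "fourier_slice (A *\<^sub>T B) i = fourier_slice A i * fourier_slice B i"
proof (rule eq_matI)
  note C = t_prod_carrier(1)[OF A B p]
  note cA = fourier_slice_carrier[OF A p, of i] and cB = fourier_slice_carrier[OF B p, of i]
  fix a b
  assume "a < dim_row (fourier_slice A i * fourier_slice B i)"
    "b < dim_col (fourier_slice A i * fourier_slice B i)"
  then have a: "a < m" and b: "b < l" using cA cB by auto
  define \<omega> where "\<omega> = exp (2 * complex_of_real pi * \<i> / of_nat p)"
  define F where "F = (\<lambda>c r. \<omega> ^ (i * r) * (A ! r) $$ (a, c))"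
  define G where "G = (\<lambda>c s. \<omega> ^ (i * s) * (B ! s) $$ (c, b))"
  have pw: "\<omega> ^ (i * k) = \<omega> ^ (i * ((k + p - s) mod p)) * \<omega> ^ (i * s)" if "s < p" for k s
  proof -
    have "k mod p = ((k + p - s) mod p + s) mod p"
      using that by (simp add: mod_add_left_eq)
    from root_power_mod[OF p this, folded \<omega>_def, of i]
    show ?thesis by (simp add: distrib_left power_add)
  qed
  have "fourier_slice (A *\<^sub>T B) i $$ (a, b) =
      (\<Sum>k<p. \<Sum>s<p. \<Sum>c<n. \<omega> ^ (i * k) *
        ((A ! ((k + p - s) mod p)) $$ (a, c) * (B ! s) $$ (c, b)))"
    by (simp add: fourier_slice_index[OF C p a b] \<omega>_def t_prod_index[OF A B p _ a b] sum_distrib_left)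
  also have "\<dots> = (\<Sum>k<p. \<Sum>s<p. \<Sum>c<n. F c ((k + p - s) mod p) * G c s)"
  proof (intro sum.cong refl)
    fix k s c assume "s \<in> {..<p}"
    then show "\<omega> ^ (i * k) * ((A ! ((k + p - s) mod p)) $$ (a, c) * (B ! s) $$ (c, b)) =
        F c ((k + p - s) mod p) * G c s"
      using pw[of s k] unfolding F_def G_def by (simp only: lessThan_iff mult_ac)
  qed
  \<comment> \<open>With \<open>s\<close> fixed outside, the cyclic shift by \<open>s\<close> merely
    permutes the range of \<open>k\<close>, so it can be removed by reindexing.\<close>
  also have "\<dots> = (\<Sum>s<p. \<Sum>k<p. \<Sum>c<n. F c ((k + p - s) mod p) * G c s)"
    by (rule sum.swap)
  also have "\<dots> = (\<Sum>s<p. \<Sum>r<p. \<Sum>c<n. F c r * G c s)"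
  proof (rule sum.cong[OF refl])
    fix s assume "s \<in> {..<p}"
    then show "(\<Sum>k<p. \<Sum>c<n. F c ((k + p - s) mod p) * G c s) = (\<Sum>r<p. \<Sum>c<n. F c r * G c s)"
      using sum.reindex_bij_betw[OF circ_shift_bij, of s p "\<lambda>r. \<Sum>c<n. F c r * G c s"] by simp
  qed
  \<comment> \<open>The contraction index \<open>c\<close> moves outermost; for each
    \<open>c\<close> the sums over \<open>r\<close> and \<open>s\<close> are then independent and
    factor.\<close>
  also have "\<dots> = (\<Sum>s<p. \<Sum>c<n. \<Sum>r<p. F c r * G c s)"
    by (rule sum.cong[OF refl], rule sum.swap)
  also have "\<dots> = (\<Sum>c<n. \<Sum>s<p. \<Sum>r<p. F c r * G c s)"
    by (rule sum.swap)
  also have "\<dots> = (\<Sum>c<n. (\<Sum>r<p. F c r) * (\<Sum>s<p. G c s))"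
    by (simp add: sum_distrib_left sum_distrib_right)
  also have "\<dots> = (\<Sum>c<n. fourier_slice A i $$ (a, c) * fourier_slice B i $$ (c, b))"
    unfolding F_def G_def \<omega>_def
    by (intro sum.cong refl)
      (simp add: fourier_slice_index[OF A p a] fourier_slice_index[OF B p _ b])
  also have "\<dots> = (fourier_slice A i * fourier_slice B i) $$ (a, b)"
    using cA cB a b by (simp add: scalar_prod_def atLeast0LessThan)
  finally show "fourier_slice (A *\<^sub>T B) i $$ (a, b) = (fourier_slice A i * fourier_slice B i) $$ (a, b)" .
qed (use fourier_slice_carrier[OF t_prod_carrier(1)[OF A B p] p, of i]
      fourier_slice_carrier[OF A p, of i] fourier_slice_carrier[OF B p, of i] in auto)

lemma mat_adjoint_carrier:
  "A \<in> carrier_mat m n \<Longrightarrow> mat_adjoint A \<in> carrier_mat n m"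
  by (auto simp: mat_adjoint_def)

lemma mat_adjoint_index:
  fixes A :: "complex mat"
  assumes "A \<in> carrier_mat m n" "a < n" "b < m"
  shows "mat_adjoint A $$ (a, b) = cnj (A $$ (b, a))"
  using assms by (simp add: mat_adjoint_def mat_of_rows_def)

text \<open>Negation modulo \<open>p\<close> merges the two cases of the definition, because
  \<open>(p - 0) mod p = 0\<close>; in this form the index map can be treated as a
  permutation.\<close>

lemma t_adjoint_nth:
  assumes "A \<in> carrier_tensor m n p" "k < p"
  shows "t_adjoint A ! k = mat_adjoint (A ! ((p - k) mod p))"
  using assms carrier_tensorD(1)[OF assms(1)] by (simp add: t_adjoint_def)

lemma t_adjoint_carrier:
  assumes "A \<in> carrier_tensor m n p"
  shows "t_adjoint A \<in> carrier_tensor n m p"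
proof -
  have "t_adjoint A ! k \<in> carrier_mat n m" if "k < p" for k
    unfolding t_adjoint_nth[OF assms that]
    using that by (intro mat_adjoint_carrier carrier_tensorD(2)[OF assms]) auto
  moreover have "length (t_adjoint A) = p"
    using carrier_tensorD(1)[OF assms] by (simp add: t_adjoint_def)
  ultimately show ?thesis by (simp add: carrier_tensor_def)
qed

text \<open>Conjugation inverts \<omega>, which has modulus 1, and the index reversal in
  \<open>t_adjoint\<close> undoes this inversion.\<close>

lemma fourier_slice_t_adjoint:
  assumes A: "A \<in> carrier_tensor m n p" and p: "p > 0"
  shows "fourier_slice (t_adjoint A) i = mat_adjoint (fourier_slice A i)"
proof (rule eq_matI)
  note H = t_adjoint_carrier[OF A]
  note cA = fourier_slice_carrier[OF A p, of i]
  fix a b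
  assume "a < dim_row (mat_adjoint (fourier_slice A i))" "b < dim_col (mat_adjoint (fourier_slice A i))"
  then have a: "a < n" and b: "b < m" using mat_adjoint_carrier[OF cA] by auto
  define \<omega> where "\<omega> = exp (2 * complex_of_real pi * \<i> / of_nat p)"
  \<comment> \<open>Both sides are the multiplicative inverse of
    \<open>\<omega> ^ (i * ((p - k) mod p))\<close>: the left one by modulus 1, the right one
    because the exponents add up to a multiple of \<open>p\<close>.\<close>
  have conj: "cnj (\<omega> ^ (i * ((p - k) mod p))) = \<omega> ^ (i * k)" if k: "k < p" for k
  proof -
    have inv: "cnj \<omega> * \<omega> = 1"
      using root_power[of p 1] by (simp add: \<omega>_def cis_cnj cis_mult)
    have "((p - k) mod p + k) mod p = 0 mod p"
      using k by (simp add: mod_add_left_eq)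
    from root_power_mod[OF p this, folded \<omega>_def, of i]
    have "\<omega> ^ (i * ((p - k) mod p)) * \<omega> ^ (i * k) = 1"
      by (simp add: distrib_left power_add)
    moreover have "cnj (\<omega> ^ (i * ((p - k) mod p))) * \<omega> ^ (i * ((p - k) mod p)) = 1"
      by (simp add: inv flip: power_mult_distrib)
    ultimately show ?thesis
      by (metis mult.assoc mult_1 mult.right_neutral)
  qed
  \<comment> \<open>Negation modulo \<open>p\<close> is an involution, hence serves as its own
    inverse witness.\<close>
  have bij: "bij_betw (\<lambda>k. (p - k) mod p) {..<p} {..<p}"
  proof -
    have "(p - (p - k) mod p) mod p = k" if "k < p" for k
      using that by (cases "k = 0") auto
    then show ?thesis
      using p by (intro bij_betw_byWitness[where f' = "\<lambda>k. (p - k) mod p"]) auto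
  qed
  have "fourier_slice (t_adjoint A) i $$ (a, b) =
      (\<Sum>k<p. \<omega> ^ (i * k) * cnj ((A ! ((p - k) mod p)) $$ (b, a)))"
    unfolding fourier_slice_index[OF H p a b] \<omega>_def
  proof (intro sum.cong refl)
    fix k assume "k \<in> {..<p}"
    then show "exp (2 * complex_of_real pi * \<i> / of_nat p) ^ (i * k) * (t_adjoint A ! k) $$ (a, b) =
        exp (2 * complex_of_real pi * \<i> / of_nat p) ^ (i * k) * cnj ((A ! ((p - k) mod p)) $$ (b, a))"
      using p by (simp add: t_adjoint_nth[OF A] mat_adjoint_index[OF carrier_tensorD(2)[OF A] a b])
  qed
  also have "\<dots> = (\<Sum>k<p. cnj (\<omega> ^ (i * ((p - k) mod p)) * (A ! ((p - k) mod p)) $$ (b, a)))"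
    by (intro sum.cong refl) (simp only: complex_cnj_mult conj lessThan_iff)
  also have "\<dots> = (\<Sum>k<p. cnj (\<omega> ^ (i * k) * (A ! k) $$ (b, a)))"
    by (rule sum.reindex_bij_betw[OF bij])
  also have "\<dots> = mat_adjoint (fourier_slice A i) $$ (a, b)"
    by (simp only: mat_adjoint_index[OF cA a b] fourier_slice_index[OF A p b a] cnj_sum \<omega>_def)
  finally show "fourier_slice (t_adjoint A) i $$ (a, b) = mat_adjoint (fourier_slice A i) $$ (a, b)" .
qed (use fourier_slice_carrier[OF t_adjoint_carrier[OF A] p, of i]
      mat_adjoint_carrier[OF fourier_slice_carrier[OF A p, of i]] in auto)

theorem theorem3p11:
  fixes n p :: nat and S :: tensor
  assumes "n \<ge> 1" and "p \<ge> 1"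
    and "S \<in> carrier_tensor (2 * n) (2 * n) p"
  shows "t_symplectic n p S \<longleftrightarrow> (\<forall>i<p. symplectic n (fourier_slice S i))"
proof -
  note S = assms(3)
  have p: "p > 0" using assms(2) by simp
  let ?J = "t_symp_unit n p"
  note J = t_symp_unit_eq(2)[OF p, of n] t_symp_unit_eq(3)[OF p, where n = n]
  note H = t_adjoint_carrier[OF S]
  note HJ = t_prod_carrier(1)[OF H J(1) p]
  note HJS = t_prod_carrier(1)[OF HJ S p]
  have slice: "fourier_slice (t_adjoint S *\<^sub>T ?J *\<^sub>T S) i =
      mat_adjoint (fourier_slice S i) * symp_unit n * fourier_slice S i" if "i < p" for i
    by (simp add: fourier_slice_t_prod[OF HJ S p] fourier_slice_t_prod[OF H J(1) p]
        fourier_slice_t_adjoint[OF S p] J(2)[OF that])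
  \<comment> \<open>Only the direction from slices to tensors has content; it is the injectivity of
    the Fourier transform on tensors of equal dimensions.\<close>
  have "t_adjoint S *\<^sub>T ?J *\<^sub>T S = ?J \<longleftrightarrow>
      (\<forall>i<p. fourier_slice (t_adjoint S *\<^sub>T ?J *\<^sub>T S) i = fourier_slice ?J i)"
    using fourier_slice_inj[OF HJS J(1) p] by auto
  then show ?thesis
    using S fourier_slice_carrier[OF S p]
    by (simp add: t_symplectic_def symplectic_def slice J(2))
qed

end
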